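(* Let $H:\mathbb{R}^d\times\mathbb{R}^m\to\mathbb{R}^d$ be measurable, and let $\{Y_i\}_{i=-\infty}^{\infty}$ and $\{N_i\}_{i=-\infty}^{\infty}$ be random sequences with values in $\mathbb{R}^m$ and $\mathbb{R}^d$ respectively. Assume that the sequence $\{(Y_i,N_{i+1})\}_{i=-\infty}^{\infty}$ is stationary and ergodic, and that there is $\lambda_0>0$ such that for all $0<\lambda<\lambda_0$ $$\mathbb{E}\big|-\lambda H(0,Y_1)+\sqrt{2\lambda}\,N_2\big|<\infty,$$ and, for all $x,x'\in\mathbb{R}^d$ and all $z=(y,u)\in\mathbb{R}^m\times\mathbb{R}^d$, $$|x-\lambda H(x,y)-(x'-\lambda H(x',y))|\le K_z|x-x'|,$$ where $z\mapsto K_z\in[0,\infty)$ is a (measurable) function, which may depend on $\lambda$, satisfying $$\mathbb{E}\{\log K_{Z_1}\}<0,\qquad Z_1:=(Y_0,N_1).$$ Then, for all $0<\lambda<\lambda_0$, the class $\{X_n(v),\ v\in\mathbb{R}^d\}$ defined by $X_0(v)=v$ and $$X_{n+1}(v)=X_n(v)-\lambda H(X_n(v),Y_n)+\sqrt{2\lambda}\,N_{n+1},\quad n\ge0,$$ is strongly stable.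
   Context: $|\cdot|$ is the Euclidean norm on $\mathbb{R}^d$. For a random vector $V$ in $\mathbb{R}^d$ (defined on the same probability space as the driving sequences, and allowed to depend on their entire trajectories), $X_n(V)$ denotes the process defined by the recursion with $X_0=V$. Definition (strong stability). The class $\{X_n(v),\ v\in\mathbb{R}^d\}$ is called strongly stable if (I) there exists a random vector $V^*$ such that $\{X_i(V^* )\}_{i=0}^{\infty}$ is stationary and ergodic, and (II) for any random vector $V$, $X_n(V)-X_n(V^* )\to 0$ almost surely as $n\to\infty$. *)

theory Defs
  imports "HOL-Probability.Probability"
begin

text \<open>
  The index type of a process is \<^typ>\<open>int\<close> (two-sided) or \<^typ>\<open>nat\<close> (one-sided); the law of a process
  is a measure on the path space with its product sigma-algebra, and the shift acts on paths.
\<close>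

definition process_law ::
    "'w measure \<Rightarrow> ('i \<Rightarrow> 'w \<Rightarrow> 'v::topological_space) \<Rightarrow> ('i \<Rightarrow> 'v) measure" where
  "process_law M X = distr M (Pi\<^sub>M UNIV (\<lambda>_. borel)) (\<lambda>w i. X i w)"

definition shift :: "('i::{plus,one} \<Rightarrow> 'v) \<Rightarrow> 'i \<Rightarrow> 'v" where
  "shift x = (\<lambda>i. x (i + 1))"

definition stationary ::
    "'w measure \<Rightarrow> ('i::{plus,one} \<Rightarrow> 'w \<Rightarrow> 'v::topological_space) \<Rightarrow> bool" where
  "stationary M X \<longleftrightarrow>
     (\<forall>i. X i \<in> borel_measurable M) \<and> process_law M (shift X) = process_law M X"

text \<open>
  The law gives probability 0 or 1 to every measurable shift-invariant set of paths (the space of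
  the product measure here is all of \<^term>\<open>UNIV\<close>).
\<close>

definition ergodic ::
    "'w measure \<Rightarrow> ('i::{plus,one} \<Rightarrow> 'w \<Rightarrow> 'v::topological_space) \<Rightarrow> bool" where
  "ergodic M X \<longleftrightarrow>
     (\<forall>A \<in> sets (Pi\<^sub>M UNIV (\<lambda>_. borel)).
        shift -` A = A \<longrightarrow> measure (process_law M X) A \<in> {0, 1})"

text \<open>
  The logarithm on \<open>[0,\<infinity>)\<close> with \<open>log 0 = -\<infinity>\<close>, and the expectation of an extended real random
  variable.  As \<open>\<infinity> - \<infinity> = \<infinity>\<close> in \<^typ>\<open>ereal\<close>, an expectation below 0 is always well-defined,
  i.e. the positive part is integrable; the value \<open>-\<infinity>\<close> is allowed.
\<close>

definition ext_ln :: "real \<Rightarrow> ereal" where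
  "ext_ln x = (if x = 0 then - \<infinity> else ereal (ln x))"

definition ext_expectation :: "'w measure \<Rightarrow> ('w \<Rightarrow> ereal) \<Rightarrow> ereal" where
  "ext_expectation M f =
     enn2ereal (\<integral>\<^sup>+ w. e2ennreal (f w) \<partial>M) - enn2ereal (\<integral>\<^sup>+ w. e2ennreal (- f w) \<partial>M)"

text \<open>
  The recursion is started in a random vector \<open>V\<close>, which may depend on the whole trajectories of
  \<open>Y\<close> and \<open>N\<close>; a deterministic start \<open>v\<close> is \<open>V = (\<lambda>_. v)\<close>.
\<close>

primrec langevin ::
    "((real^'d) \<times> (real^'m) \<Rightarrow> real^'d) \<Rightarrow> real \<Rightarrow> (int \<Rightarrow> 'w \<Rightarrow> real^'m) \<Rightarrow>
     (int \<Rightarrow> 'w \<Rightarrow> real^'d) \<Rightarrow> ('w \<Rightarrow> real^'d) \<Rightarrow> nat \<Rightarrow> 'w \<Rightarrow> real^'d" where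
  "langevin H lam Y N V 0 = V"
| "langevin H lam Y N V (Suc n) =
     (\<lambda>w. langevin H lam Y N V n w
            - lam *\<^sub>R H (langevin H lam Y N V n w, Y (int n) w)
            + sqrt (2 * lam) *\<^sub>R N (int n + 1) w)"

text \<open>
  Here \<open>X V\<close> is the process started in the random vector \<open>V\<close>; the vectors \<open>V\<close> live on the
  probability space \<open>M\<close> that carries the driving sequences.
\<close>

definition strongly_stable ::
    "'w measure \<Rightarrow> (('w \<Rightarrow> real^'d) \<Rightarrow> nat \<Rightarrow> 'w \<Rightarrow> real^'d) \<Rightarrow> bool" where
  "strongly_stable M X \<longleftrightarrow>
     (\<exists>Vs \<in> borel_measurable M.
        stationary M (X Vs) \<and> ergodic M (X Vs) \<and>
        (\<forall>V \<in> borel_measurable M. AE w in M. (\<lambda>n. X V n w - X Vs n w) \<longlonglongrightarrow> 0))"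

end

theory Submission
  imports Defs
begin

text \<open>
  For an integrable \<open>g\<close> with negative mean the Birkhoff sums along an ergodic map are almost surely
  bounded above. Applied to \<open>log K + d\<close> with a small \<open>d > 0\<close>, this makes the products of the
  Lipschitz constants \<open>K\<close> along the forward and the backward orbit of the driving path decay
  exponentially. The backward iterates started at 0 therefore converge to a functional \<open>\<Psi>\<close> of the
  past of the path, and the recursion started in it follows \<open>\<Psi>\<close> along the shift orbit, so it inherits
  stationarity and ergodicity; decay of the forward products couples all other starts to it.
\<close>

section \<open>Ergodic measure-preserving maps and their Birkhoff sums\<close>

text \<open>The map stays abstract because two maps on one path space are used: the backward shift
  builds the stationary start, the forward shift drives the recursion and the coupling. Only
  strictly invariant sets occur in the ergodicity condition, as in \<open>ergodic\<close>.\<close>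

locale ergodic_map = prob_space P for P :: "'a measure" +
  fixes T :: "'a \<Rightarrow> 'a"
  assumes T_measurable [measurable]: "T \<in> measurable P P"
    and T_preserves: "distr P P T = P"
    and T_ergodic: "\<And>A. A \<in> sets P \<Longrightarrow> T -` A \<inter> space P = A \<Longrightarrow> prob A \<in> {0, 1}"
begin

lemma iterate_measurable [measurable]: "T ^^ n \<in> measurable P P"
  by (induction n) (auto intro: measurable_comp[of _ P P _ P] simp: measurable_ident)

lemma iterate_preserves: "distr P P (T ^^ n) = P"
proof (induction n)
  case (Suc n)
  have "distr P P (T ^^ Suc n) = distr (distr P P (T ^^ n)) P T"
    by (subst distr_distr) auto
  also have "\<dots> = P" unfolding Suc by (rule T_preserves)
  finally show ?case .
qed (simp add: distr_id2 id_def)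

lemma AE_iterates:
  assumes "AE x in P. Q x"
  shows "AE x in P. \<forall>n. Q ((T ^^ n) x)"
proof -
  have "AE x in P. Q ((T ^^ n) x)" for n
  proof (rule AE_distrD[OF iterate_measurable])
    show "AE x in distr P P (T ^^ n). Q x" unfolding iterate_preserves by (rule assms)
  qed
  then show ?thesis by (simp add: AE_all_countable)
qed

text \<open>
  Garsia's argument: the running maxima \<open>m\<close> satisfy \<open>E (m (n + 1) - m n \<circ> T) \<ge> 0\<close>, while the
  integrand becomes \<open>g\<close> wherever the maxima tend to infinity.
\<close>

lemma birkhoff_sums_bdd_above:
  fixes g :: "'a \<Rightarrow> real"
  assumes g: "integrable P g" and neg: "(\<integral>x. g x \<partial>P) < 0"
  shows "AE x in P. bdd_above (range (\<lambda>n. \<Sum>j<n. g ((T ^^ j) x)))"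
proof -
  have [measurable]: "g \<in> borel_measurable P" using g by auto
  \<comment> \<open>The recursion produces the maximum of the Birkhoff sums of lengths 0 to
    \<open>n\<close>, with the empty sum included; this form relates \<open>m (Suc n) x\<close>
    directly to \<open>m n (T x)\<close>.\<close>
  define m where "m = rec_nat (\<lambda>_. 0) (\<lambda>_ f x. max 0 (g x + f (T x)))"
  have m0: "m 0 x = 0" and mS: "m (Suc n) x = max 0 (g x + m n (T x))" for n x
    by (simp_all add: m_def)
  have m_int: "integrable P (m n)" for n
  proof (induction n)
    case (Suc n)
    have "integrable (distr P P T) (m n)" using Suc by (simp add: T_preserves)
    then have "integrable P (\<lambda>x. m n (T x))"
      by (rule integrable_distr[OF T_measurable])
    then show ?case using g unfolding mS[abs_def]
      by (intro integrable_max Bochner_Integration.integrable_add) auto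
  qed (simp add: m0[abs_def])
  then have [measurable]: "m n \<in> borel_measurable P" for n by auto
  have m_nonneg: "0 \<le> m n x" for n x by (cases n) (auto simp: m0 mS)
  have m_step: "m n x \<le> m (Suc n) x" for n x
  proof (induction n arbitrary: x)
    case (Suc n)
    then have "m n (T x) \<le> m (Suc n) (T x)" by blast
    then show ?case by (simp add: mS[of n x] mS[of "Suc n" x])
  qed (simp add: m0 m_nonneg)
  have m_mono: "i \<le> n \<Longrightarrow> m i x \<le> m n x" for i n x
    by (rule lift_Suc_mono_le[of "\<lambda>n. m n x"]) (auto simp: m_step)
  have sums_le: "(\<Sum>j<n. g ((T ^^ j) x)) \<le> m n x" for n x
  proof (induction n arbitrary: x)
    case (Suc n)
    have "(\<Sum>j<Suc n. g ((T ^^ j) x)) = g x + (\<Sum>j<n. g ((T ^^ j) (T x)))"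
      unfolding sum.lessThan_Suc_shift by (simp add: funpow_Suc_right del: funpow.simps)
    also have "\<dots> \<le> m (Suc n) x" using Suc[of "T x"] by (simp add: mS)
    finally show ?case .
  qed (simp add: m0)
  \<comment> \<open>Off \<open>A\<close> the maxima, and hence the Birkhoff sums, are bounded above.
    It remains to show that \<open>A\<close> is invariant and to exclude probability 1.\<close>
  define A where "A = {x \<in> space P. \<forall>c::nat. \<exists>n. m n x > real c}"
  have A_sets: "A \<in> sets P" unfolding A_def by measurable
  have unbounded_T: "(\<forall>c::nat. \<exists>n. m n (T x) > real c) \<longleftrightarrow> (\<forall>c::nat. \<exists>n. m n x > real c)" for x
  proof safe
    fix c :: nat assume *: "\<forall>c::nat. \<exists>n. m n (T x) > real c"
    obtain c' :: nat where c': "real c' \<ge> real c - g x" using real_arch_simple by blast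
    obtain n where "m n (T x) > real c'" using * by blast
    then have "m (Suc n) x > real c" using c' by (simp add: mS)
    then show "\<exists>n. m n x > real c" by blast
  next
    fix c :: nat assume *: "\<forall>c::nat. \<exists>n. m n x > real c"
    obtain c' :: nat where c': "real c' \<ge> real c + \<bar>g x\<bar>" using real_arch_simple by blast
    obtain n where n: "m n x > real c'" using * by blast
    \<comment> \<open>A positive maximum excludes \<open>n = 0\<close> and the branch 0 of
      \<open>max\<close>, so \<open>m n x = g x + m k (T x)\<close>.\<close>
    then obtain k where "n = Suc k" using c' by (cases n) (auto simp: m0)
    then have "m k (T x) > real c" using c' n by (auto simp: mS max_def split: if_splits)
    then show "\<exists>n. m n (T x) > real c" by blast
  qed
  have "T -` A \<inter> space P = A"
    using measurable_space[OF T_measurable] unfolding A_def by (auto simp: unbounded_T)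
  then have A01: "prob A \<in> {0, 1}" by (rule T_ergodic[OF A_sets])
  have "prob A \<noteq> 1"
  proof
    assume "prob A = 1"
    then have A_AE: "AE x in P. x \<in> A" by (subst AE_in_set_eq_1) (use A_sets in auto)
    \<comment> \<open>Since \<open>T\<close> preserves \<open>P\<close>, \<open>m n (T x)\<close>
      has the same mean as \<open>m n\<close>, so the growth of \<open>m\<close> in \<open>n\<close>
      makes the mean of \<open>d n\<close> nonnegative.\<close>
    define d where "d n x = m (Suc n) x - m n (T x)" for n x
    \<comment> \<open>This form gives both inputs of dominated convergence: on \<open>A\<close> the
      first argument eventually drops below \<open>g x\<close>; and it is never positive, so
      whenever it is the larger one, \<open>d n x\<close> lies between \<open>g x\<close> and
      0.\<close>
    have d_eq: "d n x = max (- m n (T x)) (g x)" for n x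
      unfolding d_def mS by (auto simp: max_def)
    have [measurable]: "d n \<in> borel_measurable P" for n unfolding d_def[abs_def] by measurable
    have d_nonneg: "0 \<le> (\<integral>x. d n x \<partial>P)" for n
    proof -
      have "integrable (distr P P T) (m n)" using m_int by (simp add: T_preserves)
      then have i: "integrable P (\<lambda>x. m n (T x))" by (rule integrable_distr[OF T_measurable])
      have "(\<integral>x. m n (T x) \<partial>P) = (\<integral>x. m n x \<partial>distr P P T)"
        by (rule integral_distr[symmetric]) auto
      then have "(\<integral>x. m n (T x) \<partial>P) = (\<integral>x. m n x \<partial>P)" by (simp add: T_preserves)
      moreover have "(\<integral>x. m n x \<partial>P) \<le> (\<integral>x. m (Suc n) x \<partial>P)"
        by (intro integral_mono m_int m_step)
      moreover have "(\<integral>x. d n x \<partial>P) = (\<integral>x. m (Suc n) x \<partial>P) - (\<integral>x. m n (T x) \<partial>P)"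
        unfolding d_def by (rule Bochner_Integration.integral_diff[OF m_int i])
      ultimately show ?thesis by simp
    qed
    have "(\<lambda>n. \<integral>x. d n x \<partial>P) \<longlonglongrightarrow> (\<integral>x. g x \<partial>P)"
    proof (rule integral_dominated_convergence[where w = "\<lambda>x. \<bar>g x\<bar>"])
      show "AE x in P. (\<lambda>n. d n x) \<longlonglongrightarrow> g x"
        using A_AE
      proof eventually_elim
        case (elim x)
        obtain c :: nat where c: "real c \<ge> - g x" using real_arch_simple by blast
        have "\<forall>c::nat. \<exists>n. m n (T x) > real c" using elim by (simp add: unbounded_T A_def)
        then obtain n0 where n0: "m n0 (T x) > real c" by blast
        have "d n x = g x" if "n \<ge> n0" for n
          using m_mono[OF that, of "T x"] n0 c unfolding d_eq by simp
        then show ?case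
          by (intro tendsto_eventually) (auto simp: eventually_sequentially)
      qed
      show "AE x in P. norm (d n x) \<le> \<bar>g x\<bar>" for n
      proof (rule AE_I2)
        fix x show "norm (d n x) \<le> \<bar>g x\<bar>"
          using m_nonneg[of n "T x"] unfolding d_eq by (auto simp: max_def)
      qed
    qed (use g in auto)
    then have "0 \<le> (\<integral>x. g x \<partial>P)" by (rule LIMSEQ_le_const) (use d_nonneg in auto)
    then show False using neg by simp
  qed
  then have "prob A = 0" using A01 by auto
  then have "AE x in P. x \<notin> A" using A_sets by (simp add: prob_eq_0)
  then show ?thesis
    using AE_space
  proof eventually_elim
    case (elim x)
    then obtain c :: nat where "\<And>n. m n x \<le> real c" unfolding A_def by (auto simp: not_less)
    then show ?case using sums_le order_trans by (intro bdd_aboveI[of _ "real c"]) blast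
  qed
qed

section \<open>Almost sure series and product estimates along orbits\<close>

text \<open>By invariance the terms have means forming a geometric series, so the sum of the series
  has finite expectation and is finite almost everywhere.\<close>

lemma summable_discounted_orbit:
  fixes h :: "'a \<Rightarrow> real"
  assumes h: "integrable P h" and nonneg: "\<And>x. 0 \<le> h x" and d: "0 < d"
  shows "AE x in P. summable (\<lambda>n. exp (- d * real n) * h ((T ^^ n) x))"
proof -
  have [measurable]: "h \<in> borel_measurable P" using h by auto
  have eq: "(\<integral>\<^sup>+x. ennreal (exp (- d * real n) * h ((T ^^ n) x)) \<partial>P)
      = ennreal (exp (- d) ^ n * (\<integral>x. h x \<partial>P))" for n
  proof -
    have "(\<integral>\<^sup>+x. ennreal (exp (- d * real n) * h ((T ^^ n) x)) \<partial>P)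
        = (\<integral>\<^sup>+x. ennreal (exp (- d * real n) * h x) \<partial>distr P P (T ^^ n))"
      by (rule nn_integral_distr[symmetric]) auto
    also have "\<dots> = ennreal (\<integral>x. exp (- d * real n) * h x \<partial>P)"
      unfolding iterate_preserves
      by (rule nn_integral_eq_integral) (use h nonneg in auto)
    finally show ?thesis by (simp add: exp_of_nat_mult[symmetric] mult.commute)
  qed
  have "summable (\<lambda>n. exp (- d) ^ n * (\<integral>x. h x \<partial>P))"
    using d by (intro summable_mult2 summable_geometric) auto
  then have "(\<Sum>n. ennreal (exp (- d) ^ n * (\<integral>x. h x \<partial>P))) \<noteq> \<infinity>"
    by (simp add: suminf_ennreal2 nonneg)
  then have "(\<integral>\<^sup>+x. (\<Sum>n. ennreal (exp (- d * real n) * h ((T ^^ n) x))) \<partial>P) \<noteq> \<infinity>"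
    by (subst nn_integral_suminf, measurable) (simp only: eq not_False_eq_True)
  then have "AE x in P. (\<Sum>n. ennreal (exp (- d * real n) * h ((T ^^ n) x))) \<noteq> \<infinity>"
    by (intro nn_integral_PInf_AE) auto
  then show ?thesis
    by eventually_elim (auto intro: summable_suminf_not_top simp: nonneg)
qed

text \<open>The logarithm is truncated from below, as its mean may be \<open>-\<infinity>\<close>.\<close>

lemma log_truncation:
  fixes k :: "'a \<Rightarrow> real"
  assumes [measurable]: "k \<in> borel_measurable P" and nonneg: "\<And>x. 0 \<le> k x"
    and neg: "ext_expectation P (\<lambda>x. ext_ln (k x)) < 0"
  obtains g where "integrable P g" "(\<integral>x. g x \<partial>P) < 0" "\<And>x. k x \<le> exp (g x)"
proof -
  define p where "p = (\<integral>\<^sup>+x. e2ennreal (ext_ln (k x)) \<partial>P)"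
  define q where "q = (\<integral>\<^sup>+x. e2ennreal (- ext_ln (k x)) \<partial>P)"
  have pq: "enn2ereal p - enn2ereal q < 0"
    using neg unfolding ext_expectation_def p_def q_def .
  \<comment> \<open>In \<open>ereal\<close> an infinite \<open>p\<close> would make the difference
    \<infinity>, even when \<open>q\<close> is infinite too.\<close>
  then have p_fin: "p \<noteq> \<infinity>" by auto
  have p_less: "p < q"
  proof (rule ccontr)
    assume "\<not> p < q"
    then have "enn2ereal q \<le> enn2ereal p" by (simp add: less_eq_ennreal.rep_eq[symmetric] not_less)
    then show False using pq by (cases "enn2ereal p"; cases "enn2ereal q") auto
  qed
  \<comment> \<open>Cutting \<open>k\<close> off at \<open>exp (- i)\<close> leaves the positive
    part of the logarithm unchanged and caps its negative part at \<open>i\<close>, also where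
    \<open>k\<close> vanishes. The capped negative parts increase to the full one as
    \<open>i\<close> grows.\<close>
  define g where "g i x = ln (max (k x) (exp (- real i)))" for i x
  have [measurable]: "g i \<in> borel_measurable P" for i unfolding g_def[abs_def] by measurable
  have g_eq: "g i x = max (ln (k x)) (- real i)" if "0 < k x" for i x
  proof (cases "k x \<le> exp (- real i)")
    case True
    then have "ln (k x) \<le> - real i" using that by (metis ln_exp ln_le_cancel_iff exp_gt_zero)
    then show ?thesis using True by (simp add: g_def max_def)
  next
    case False
    then have "- real i \<le> ln (k x)" using that by (simp add: ln_ge_iff)
    then show ?thesis using False by (simp add: g_def max_def)
  qed
  have g_neg: "ennreal (- g i x) = min (e2ennreal (- ext_ln (k x))) (of_nat i)" for i x
  proof (cases "k x = 0")
    case True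
    then show ?thesis
      by (simp add: g_def ext_ln_def top_ennreal.abs_eq[symmetric] ennreal_of_nat_eq_real_of_nat)
  next
    case False
    then have "0 < k x" using nonneg[of x] by simp
    then have "- g i x = min (- ln (k x)) (real i)" by (simp add: g_eq)
    then show ?thesis
      using False by (simp add: ext_ln_def ennreal_of_nat_eq_real_of_nat e2ennreal_ereal
          min_of_mono[of ennreal] mono_def ennreal_leI)
  qed
  have g_pos: "ennreal (g i x) = e2ennreal (ext_ln (k x))" for i x
  proof (cases "k x = 0")
    case True
    then show ?thesis
      by (simp add: g_def ext_ln_def e2ennreal_neg ennreal_neg)
  next
    case False
    then have "0 < k x" using nonneg[of x] by simp
    then show ?thesis
      using order_trans[of "ln (k x)" "- real i" 0]
      by (auto simp: g_eq ext_ln_def e2ennreal_ereal max_def ennreal_neg)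
  qed
  have "(SUP i. min (e2ennreal (- ext_ln (k x))) (of_nat i)) = e2ennreal (- ext_ln (k x))" for x
    by (simp flip: inf_min inf_SUP add: ennreal_SUP_of_nat_eq_top)
  then have "q = (\<integral>\<^sup>+x. (SUP i. ennreal (- g i x)) \<partial>P)" unfolding q_def g_neg by simp
  also have "\<dots> = (SUP i. \<integral>\<^sup>+x. ennreal (- g i x) \<partial>P)"
  proof (rule nn_integral_monotone_convergence_SUP)
    show "incseq (\<lambda>i x. ennreal (- g i x))"
      unfolding g_neg by (intro incseq_SucI le_funI min.mono order_refl of_nat_mono) simp
  qed auto
  \<comment> \<open>Because \<open>p < q\<close>, where \<open>q\<close> may be infinite, some
    finite truncation level already has a negative part of mean above \<open>p\<close>.\<close>
  finally obtain i where i: "p < (\<integral>\<^sup>+x. ennreal (- g i x) \<partial>P)"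
    using p_less by (auto simp: less_SUP_iff)
  have n_fin: "(\<integral>\<^sup>+x. ennreal (- g i x) \<partial>P) \<noteq> \<infinity>"
  proof -
    have "(\<integral>\<^sup>+x. ennreal (- g i x) \<partial>P) \<le> (\<integral>\<^sup>+x. of_nat i \<partial>P)"
      unfolding g_neg by (intro nn_integral_mono) auto
    then show ?thesis by (auto simp: emeasure_space_1 top_unique)
  qed
  have p_eq: "(\<integral>\<^sup>+x. ennreal (g i x) \<partial>P) = p" by (simp add: g_pos p_def)
  have int: "integrable P (g i)"
    unfolding real_integrable_def using p_fin n_fin p_eq by simp
  have "enn2real p < enn2real (\<integral>\<^sup>+x. ennreal (- g i x) \<partial>P)"
    using i n_fin p_fin by (simp add: enn2real_less_iff less_top)
  then have "(\<integral>x. g i x \<partial>P) < 0" by (subst real_lebesgue_integral_def[OF int]) (simp add: p_eq)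
  moreover have "k x \<le> exp (g i x)" for x unfolding g_def by (simp add: less_max_iff_disj)
  ultimately show ?thesis using that int by blast
qed

text \<open>An upper bound on the Birkhoff sums of \<open>g + d\<close> exponentiates to a decay
  rate \<open>d\<close> for the products. The constant depends on the point, since the bound on the
  sums does.\<close>

lemma exponential_contraction:
  fixes k :: "'a \<Rightarrow> real"
  assumes k: "k \<in> borel_measurable P" "\<And>x. 0 \<le> k x"
    and neg: "ext_expectation P (\<lambda>x. ext_ln (k x)) < 0"
  obtains d where "0 < d"
    "AE x in P. \<exists>C. \<forall>n. (\<Prod>j<n. k ((T ^^ j) x)) \<le> C * exp (- d * real n)"
proof -
  obtain g where g: "integrable P g" "(\<integral>x. g x \<partial>P) < 0" and kg: "\<And>x. k x \<le> exp (g x)"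
    using log_truncation[OF k neg] by blast
  \<comment> \<open>Half of the negative drift becomes the rate; the other half keeps the mean of
    \<open>g + d\<close> negative.\<close>
  define d where "d = - (\<integral>x. g x \<partial>P) / 2"
  have d: "0 < d" using g(2) by (simp add: d_def)
  have "integrable P (\<lambda>x. g x + d)" using g(1) by simp
  moreover have "(\<integral>x. g x + d \<partial>P) < 0" using g by (simp add: d_def prob_space)
  ultimately have "AE x in P. bdd_above (range (\<lambda>n. \<Sum>j<n. g ((T ^^ j) x) + d))"
    by (rule birkhoff_sums_bdd_above)
  then have "AE x in P. \<exists>C. \<forall>n. (\<Prod>j<n. k ((T ^^ j) x)) \<le> C * exp (- d * real n)"
  proof eventually_elim
    case (elim x)
    then obtain c where c: "\<And>n. (\<Sum>j<n. g ((T ^^ j) x) + d) \<le> c"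
      by (auto simp: bdd_above_def)
    have "(\<Prod>j<n. k ((T ^^ j) x)) \<le> exp c * exp (- d * real n)" for n
    proof -
      have "(\<Prod>j<n. k ((T ^^ j) x)) \<le> (\<Prod>j<n. exp (g ((T ^^ j) x)))"
        by (intro prod_mono) (auto simp: k kg)
      also have "\<dots> = exp ((\<Sum>j<n. g ((T ^^ j) x) + d) - d * real n)"
        by (simp add: exp_sum[symmetric] sum.distrib mult.commute)
      also have "\<dots> \<le> exp (c - d * real n)" using c by simp
      finally show ?thesis by (simp add: exp_diff exp_minus divide_inverse)
    qed
    then show ?case by blast
  qed
  then show ?thesis using that d by blast
qed

section \<open>Random fixed points and processes read off an orbit\<close>

text \<open>The fixed point is a pullback limit: \<open>V n z\<close> applies to 0 first the map at
  \<open>(T ^^ (n - 1)) z\<close> and last the map at \<open>z\<close>. Raising \<open>n\<close>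
  inserts a new innermost map, whose effect is damped by all the outer ones, so the increments are
  summable.\<close>

lemma random_fixed_point:
  fixes F :: "'x::euclidean_space \<Rightarrow> 'a \<Rightarrow> 'x"
  assumes F: "(\<lambda>(x, z). F x z) \<in> borel_measurable (borel \<Otimes>\<^sub>M P)"
    and lipschitz: "\<And>x x' z. norm (F x z - F x' z) \<le> k z * norm (x - x')"
    and F0: "integrable P (\<lambda>z. norm (F 0 z))"
    and k: "k \<in> borel_measurable P" "\<And>z. 0 \<le> k z"
    and neg: "ext_expectation P (\<lambda>z. ext_ln (k z)) < 0"
  obtains \<Psi> where "\<Psi> \<in> borel_measurable P" "AE z in P. \<Psi> z = F (\<Psi> (T z)) z"
proof -
  define V where "V = rec_nat (\<lambda>_. 0) (\<lambda>_ v z. F (v (T z)) z)"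
  have V0: "V 0 z = 0" and VS: "V (Suc n) z = F (V n (T z)) z" for n z
    by (simp_all add: V_def)
  have V_meas: "V n \<in> borel_measurable P" for n
  proof (induction n)
    case (Suc n)
    then have "(\<lambda>z. (V n (T z), z)) \<in> measurable P (borel \<Otimes>\<^sub>M P)" by measurable
    from measurable_compose[OF this F] show ?case by (simp add: VS[abs_def])
  qed (simp add: V0[abs_def])
  \<comment> \<open>Both iterates share the \<open>n\<close> outer maps; these are applied to
    \<open>F 0 ((T ^^ n) z)\<close> in one case and to 0 in the other.\<close>
  have step: "norm (V (Suc n) z - V n z)
      \<le> (\<Prod>j<n. k ((T ^^ j) z)) * norm (F 0 ((T ^^ n) z))" for n z
  proof (induction n arbitrary: z)
    case (Suc n)
    have "norm (V (Suc (Suc n)) z - V (Suc n) z) \<le> k z * norm (V (Suc n) (T z) - V n (T z))"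
      unfolding VS[of _ z] by (rule lipschitz)
    also have "\<dots> \<le> k z * ((\<Prod>j<n. k ((T ^^ j) (T z))) * norm (F 0 ((T ^^ n) (T z))))"
      by (intro mult_left_mono Suc k)
    also have "\<dots> = (\<Prod>j<Suc n. k ((T ^^ j) z)) * norm (F 0 ((T ^^ Suc n) z))"
      unfolding prod.lessThan_Suc_shift by (simp add: funpow_Suc_right del: funpow.simps)
    finally show ?case .
  qed (simp add: V0 VS)
  obtain d where d: "0 < d"
    "AE z in P. \<exists>C. \<forall>n. (\<Prod>j<n. k ((T ^^ j) z)) \<le> C * exp (- d * real n)"
    using exponential_contraction[OF k neg] by blast
  have "AE z in P. summable (\<lambda>n. exp (- d * real n) * norm (F 0 ((T ^^ n) z)))"
    using summable_discounted_orbit[OF F0 _ d(1)] by simp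
  with d(2) have conv: "AE z in P. convergent (\<lambda>n. V n z)"
  proof eventually_elim
    case (elim z)
    then obtain C where C: "\<And>n. (\<Prod>j<n. k ((T ^^ j) z)) \<le> C * exp (- d * real n)" by blast
    have "summable (\<lambda>n. V (Suc n) z - V n z)"
    proof (rule summable_comparison_test')
      show "summable (\<lambda>n. C * (exp (- d * real n) * norm (F 0 ((T ^^ n) z))))"
        using elim(2) by (rule summable_mult)
      show "norm (V (Suc n) z - V n z) \<le> C * (exp (- d * real n) * norm (F 0 ((T ^^ n) z)))" for n
        using order_trans[OF step mult_right_mono[OF C norm_ge_zero]] by (simp add: mult.assoc)
    qed
    then have "(\<lambda>n. \<Sum>i<n. V (Suc i) z - V i z) \<longlonglongrightarrow> (\<Sum>n. V (Suc n) z - V n z)"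
      by (rule summable_LIMSEQ)
    then show ?case
      unfolding sum_lessThan_telescope[of "\<lambda>i. V i z"] by (auto simp: V0 convergent_def)
  qed
  \<comment> \<open>Where the iterates diverge, \<open>lim\<close> returns a default value;
    measurability still holds on the whole space, and the equation is claimed almost
    everywhere.\<close>
  define \<Psi> where "\<Psi> z = lim (\<lambda>n. V n z)" for z
  have \<Psi>_meas: "\<Psi> \<in> borel_measurable P"
    unfolding \<Psi>_def[abs_def] by (rule borel_measurable_lim_metric) (rule V_meas)
  have "AE z in P. \<Psi> z = F (\<Psi> (T z)) z"
    \<comment> \<open>Convergence is needed at \<open>z\<close> and at \<open>T z\<close>;
      invariance of \<open>P\<close> supplies it along the whole orbit.\<close>
    using AE_iterates[OF conv]
  proof eventually_elim
    case (elim z)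
    from elim[rule_format, of 0] have l0: "(\<lambda>n. V n z) \<longlonglongrightarrow> \<Psi> z"
      by (simp add: \<Psi>_def convergent_LIMSEQ_iff)
    from elim[rule_format, of 1] have l1: "(\<lambda>n. V n (T z)) \<longlonglongrightarrow> \<Psi> (T z)"
      by (simp add: \<Psi>_def convergent_LIMSEQ_iff)
    have "(\<lambda>n. F (V n (T z)) z - F (\<Psi> (T z)) z) \<longlonglongrightarrow> 0"
    proof (rule Lim_null_comparison)
      show "(\<lambda>n. k z * norm (V n (T z) - \<Psi> (T z))) \<longlonglongrightarrow> 0"
        using tendsto_mult_left[OF tendsto_norm[OF LIM_zero[OF l1]], of "k z"] by simp
    qed (simp add: lipschitz)
    then have "(\<lambda>n. F (V n (T z)) z) \<longlonglongrightarrow> F (\<Psi> (T z)) z" by (rule LIM_zero_cancel)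
    then have "(\<lambda>n. V (Suc n) z) \<longlonglongrightarrow> F (\<Psi> (T z)) z" by (simp add: VS)
    then show ?case using LIMSEQ_Suc[OF l0] LIMSEQ_unique by blast
  qed
  then show ?thesis using that \<Psi>_meas by blast
qed

text \<open>The map \<open>\<psi>\<close> from points to observed orbits intertwines
  \<open>T\<close> with \<open>shift\<close>, so the law of \<open>X\<close> is a factor of
  \<open>P\<close>: invariance passes to the image law, and shift-invariant sets of paths pull back
  to \<open>T\<close>-invariant sets.\<close>

lemma orbit_observable_stationary_ergodic:
  fixes X :: "nat \<Rightarrow> 'w \<Rightarrow> 'v::topological_space"
  assumes \<Phi>: "\<Phi> \<in> borel_measurable P"
    and Z: "Z \<in> measurable M P" "distr M P Z = P"
    and X: "\<And>n. X n \<in> borel_measurable M"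
    and orbit: "AE w in M. \<forall>n. X n w = \<Phi> ((T ^^ n) (Z w))"
  shows "stationary M X" "ergodic M X"
proof -
  let ?B = "Pi\<^sub>M UNIV (\<lambda>_. borel) :: (nat \<Rightarrow> 'v) measure"
  define \<psi> where "\<psi> z = (\<lambda>n. \<Phi> ((T ^^ n) z))" for z
  have \<psi>: "\<psi> \<in> measurable P ?B"
    unfolding \<psi>_def[abs_def] using \<Phi> by (intro measurable_PiM_single') auto
  have shift_\<psi>: "shift (\<psi> z) = \<psi> (T z)" for z
    by (simp add: shift_def \<psi>_def funpow_Suc_right del: funpow.simps)
  have law: "process_law M X = distr P ?B \<psi>"
  proof -
    have "process_law M X = distr M ?B (\<lambda>w. \<psi> (Z w))"
      unfolding process_law_def
    proof (rule distr_cong_AE)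
      show "AE w in M. (\<lambda>i. X i w) = \<psi> (Z w)" using orbit by eventually_elim (simp add: \<psi>_def)
      show "(\<lambda>w i. X i w) \<in> measurable M ?B" using X by (intro measurable_PiM_single') auto
      show "(\<lambda>w. \<psi> (Z w)) \<in> measurable M ?B" by (rule measurable_compose[OF Z(1) \<psi>])
    qed auto
    also have "\<dots> = distr (distr M P Z) ?B \<psi>" by (simp add: distr_distr[OF \<psi> Z(1)] comp_def)
    finally show ?thesis unfolding Z(2) .
  qed
  have "process_law M (shift X) = distr M ?B (\<lambda>w. \<psi> (T (Z w)))"
    unfolding process_law_def
  proof (rule distr_cong_AE)
    show "AE w in M. (\<lambda>i. shift X i w) = \<psi> (T (Z w))"
      using orbit
      by eventually_elim (simp add: \<psi>_def shift_def funpow_Suc_right del: funpow.simps)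
    show "(\<lambda>w i. shift X i w) \<in> measurable M ?B"
      using X by (intro measurable_PiM_single') (auto simp: shift_def)
    show "(\<lambda>w. \<psi> (T (Z w))) \<in> measurable M ?B"
      by (rule measurable_compose[OF Z(1) measurable_compose[OF T_measurable \<psi>]])
  qed auto
  also have "\<dots> = distr (distr M P Z) ?B (\<lambda>z. \<psi> (T z))"
    by (simp add: distr_distr[OF measurable_compose[OF T_measurable \<psi>] Z(1)] comp_def)
  also have "\<dots> = distr (distr P P T) ?B \<psi>"
    unfolding Z(2) by (simp add: distr_distr[OF \<psi> T_measurable] comp_def)
  finally show "stationary M X"
    unfolding stationary_def law T_preserves using X by simp
  show "ergodic M X"
    unfolding ergodic_def law
  proof safe
    fix A assume A: "A \<in> sets ?B" "shift -` A = A" "measure (distr P ?B \<psi>) A \<noteq> 0"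
    have "T -` (\<psi> -` A \<inter> space P) \<inter> space P = \<psi> -` A \<inter> space P"
    proof -
      have "\<psi> (T z) \<in> A \<longleftrightarrow> \<psi> z \<in> A" for z using A(2) shift_\<psi>[of z] by (metis vimage_eq)
      then show ?thesis using measurable_space[OF T_measurable] by auto
    qed
    then have "prob (\<psi> -` A \<inter> space P) \<in> {0, 1}"
      using measurable_sets[OF \<psi> A(1)] by (intro T_ergodic)
    then show "measure (distr P ?B \<psi>) A = 1" using A by (simp add: measure_distr[OF \<psi> A(1)])
  qed
qed

end

section \<open>Forward and backward shift on two-sided path space\<close>

context
  fixes M :: "'w measure" and Z :: "int \<Rightarrow> 'w \<Rightarrow> 'v::topological_space"
  assumes prob: "prob_space M" and stat: "stationary M Z" and erg: "ergodic M Z"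
begin

lemma measurable_path: "(\<lambda>w i. Z i w) \<in> measurable M (process_law M Z)"
  using stat unfolding process_law_def stationary_def
  by (auto intro!: measurable_PiM_single')

lemma distr_path: "distr M (process_law M Z) (\<lambda>w i. Z i w) = process_law M Z"
  by (simp add: process_law_def cong: distr_cong)

lemma measurable_coordinate: "(\<lambda>z. z i) \<in> borel_measurable (process_law M Z)"
  by (simp add: process_law_def)

lemma ergodic_map_shift: "ergodic_map (process_law M Z) shift"
proof (intro ergodic_map.intro ergodic_map_axioms.intro)
  show "prob_space (process_law M Z)"
    using prob_space.prob_space_distr[OF prob measurable_path] by (simp add: distr_path)
  show m: "shift \<in> measurable (process_law M Z) (process_law M Z)"
    unfolding shift_def process_law_def by (auto intro!: measurable_PiM_single')
  have "distr (process_law M Z) (process_law M Z) shift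
      = distr (distr M (process_law M Z) (\<lambda>w i. Z i w)) (process_law M Z) shift"
    by (simp add: distr_path)
  also have "\<dots> = process_law M (shift Z)"
    unfolding distr_distr[OF m measurable_path]
    by (auto simp: process_law_def shift_def comp_def intro!: distr_cong)
  finally show "distr (process_law M Z) (process_law M Z) shift = process_law M Z"
    using stat by (simp add: stationary_def)
  show "measure (process_law M Z) A \<in> {0, 1}"
    if "A \<in> sets (process_law M Z)" "shift -` A \<inter> space (process_law M Z) = A" for A
    using erg that unfolding ergodic_def by (simp add: process_law_def space_PiM)
qed

text \<open>On two-sided paths this map is the inverse of \<open>shift\<close>, and a bijection and
  its inverse have the same invariant measures and the same invariant sets.\<close>

lemma ergodic_map_backward_shift: "ergodic_map (process_law M Z) (\<lambda>z i. z (i - 1))"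
proof -
  interpret ergodic_map "process_law M Z" shift by (rule ergodic_map_shift)
  let ?P = "process_law M Z" and ?\<sigma> = "\<lambda>(z :: int \<Rightarrow> 'v) i. z (i - 1)"
  have m: "?\<sigma> \<in> measurable ?P ?P"
    unfolding process_law_def by (auto intro!: measurable_PiM_single')
  have inverse: "?\<sigma> (shift z) = z" "shift (?\<sigma> z) = z" for z
    by (simp_all add: shift_def)
  have space: "space ?P = UNIV" by (simp add: process_law_def space_PiM)
  show ?thesis
  proof (intro ergodic_map.intro ergodic_map_axioms.intro m prob_space_axioms)
    have "distr ?P ?P ?\<sigma> = distr (distr ?P ?P shift) ?P ?\<sigma>" by (simp add: T_preserves)
    also have "\<dots> = distr ?P ?P (\<lambda>z. z)"
      unfolding distr_distr[OF m T_measurable] by (simp add: comp_def inverse)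
    finally show "distr ?P ?P ?\<sigma> = ?P" by simp
    fix A assume A: "A \<in> sets ?P" "?\<sigma> -` A \<inter> space ?P = A"
    have "shift z \<in> A \<longleftrightarrow> shift z \<in> ?\<sigma> -` A \<inter> space ?P" for z using A(2) by simp
    then have "shift z \<in> A \<longleftrightarrow> z \<in> A" for z by (simp add: inverse space)
    then have "shift -` A \<inter> space ?P = A" using space by auto
    then show "prob A \<in> {0, 1}" by (rule T_ergodic[OF A(1)])
  qed
qed

end

section \<open>Strong stability of the Langevin recursion\<close>

lemma ext_expectation_distr:
  assumes "T \<in> measurable M P" "f \<in> borel_measurable P"
  shows "ext_expectation (distr M P T) f = ext_expectation M (\<lambda>w. f (T w))"
  using assms by (simp add: ext_expectation_def nn_integral_distr)

lemma funpow_shift: "(shift ^^ n) z i = z (i + int n)"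
  by (induction n arbitrary: i) (auto simp: shift_def ac_simps)

theorem corollary1:
  fixes M :: "'w measure"
    and H :: "(real^'d) \<times> (real^'m) \<Rightarrow> real^'d"
    and Y :: "int \<Rightarrow> 'w \<Rightarrow> real^'m"
    and N :: "int \<Rightarrow> 'w \<Rightarrow> real^'d"
    and lam0 :: real
    and K :: "real \<Rightarrow> (real^'m) \<times> (real^'d) \<Rightarrow> real"
  assumes "prob_space M"
    and "H \<in> borel_measurable borel"
    and "\<And>i. Y i \<in> borel_measurable M"
    and "\<And>i. N i \<in> borel_measurable M"
    and "stationary M (\<lambda>i w. (Y i w, N (i + 1) w))"
    and "ergodic M (\<lambda>i w. (Y i w, N (i + 1) w))"
    and "lam0 > 0"
    and "\<And>lam. 0 < lam \<Longrightarrow> lam < lam0 \<Longrightarrow>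
           integrable M (\<lambda>w. norm (- lam *\<^sub>R H (0, Y 1 w) + sqrt (2 * lam) *\<^sub>R N 2 w))"
    and "\<And>lam. 0 < lam \<Longrightarrow> lam < lam0 \<Longrightarrow> K lam \<in> borel_measurable borel"
    and "\<And>lam z. 0 < lam \<Longrightarrow> lam < lam0 \<Longrightarrow> 0 \<le> K lam z"
    and "\<And>lam x x' y u. 0 < lam \<Longrightarrow> lam < lam0 \<Longrightarrow>
           norm (x - lam *\<^sub>R H (x, y) - (x' - lam *\<^sub>R H (x', y))) \<le> K lam (y, u) * norm (x - x')"
    and "\<And>lam. 0 < lam \<Longrightarrow> lam < lam0 \<Longrightarrow>
           ext_expectation M (\<lambda>w. ext_ln (K lam (Y 0 w, N 1 w))) < 0"
  shows "\<forall>lam. 0 < lam \<and> lam < lam0 \<longrightarrow> strongly_stable M (langevin H lam Y N)"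
proof (intro allI impI)
  fix lam :: real
  assume lam: "0 < lam \<and> lam < lam0"
  \<comment> \<open>\<open>Z n\<close> holds exactly the two inputs of the step from time
    \<open>n\<close> to time \<open>n + 1\<close>.\<close>
  define Z where "Z i w = (Y i w, N (i + 1) w)" for i w
  have prob: "prob_space M" and stat: "stationary M Z" and erg: "ergodic M Z"
    using assms(1,5,6) unfolding Z_def by auto
  define P where "P = process_law M Z"
  define \<sigma> :: "(int \<Rightarrow> (real^'m) \<times> (real^'d)) \<Rightarrow> int \<Rightarrow> (real^'m) \<times> (real^'d)"
    where "\<sigma> z i = z (i - 1)" for z i
  define path where "path w i = Z i w" for w i
  have path: "path \<in> measurable M P" "distr M P path = P"
    unfolding P_def path_def[abs_def]
    using measurable_path[OF prob stat erg] distr_path[OF prob stat erg] by auto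
  interpret fwd: ergodic_map P shift
    unfolding P_def by (rule ergodic_map_shift[OF prob stat erg])
  interpret bwd: ergodic_map P \<sigma>
    unfolding P_def \<sigma>_def[abs_def] by (rule ergodic_map_backward_shift[OF prob stat erg])
  have coord [measurable]: "(\<lambda>z. z i) \<in> borel_measurable P" for i
    unfolding P_def by (rule measurable_coordinate[OF prob stat erg])
  define f where "f x p = x - lam *\<^sub>R H (x, fst p) + sqrt (2 * lam) *\<^sub>R snd p"
    for x :: "real^'d" and p
  have f_meas: "(\<lambda>q. f (fst q) (snd q)) \<in> borel_measurable borel"
  proof -
    have "H \<in> borel_measurable (borel \<Otimes>\<^sub>M borel)" using assms(2) by (simp add: borel_prod)
    then show ?thesis unfolding f_def borel_prod[symmetric] by measurable
  qed
  define F where "F x z = f x (z 0)" for x and z :: "int \<Rightarrow> (real^'m) \<times> (real^'d)"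
  define k where "k z = K lam (z 0)" for z :: "int \<Rightarrow> (real^'m) \<times> (real^'d)"
  have K_meas: "K lam \<in> borel_measurable borel" using assms(9) lam by blast
  have k: "k \<in> borel_measurable P" "\<And>z. 0 \<le> k z"
    using measurable_compose[OF coord K_meas] assms(10) lam by (auto simp: k_def[abs_def])
  \<comment> \<open>The noise term cancels in the difference, which leaves the assumed Lipschitz
    estimate.\<close>
  have F_lip: "norm (F x z - F x' z) \<le> k z * norm (x - x')" for x x' z
    using assms(11)[of lam x "fst (z 0)" x' "snd (z 0)"] lam
    by (simp add: F_def f_def k_def algebra_simps)
  have F_meas: "(\<lambda>(x, z). F x z) \<in> borel_measurable (borel \<Otimes>\<^sub>M P)"
  proof -
    have "(\<lambda>q. (fst q :: real^'d, snd q 0)) \<in> borel_measurable (borel \<Otimes>\<^sub>M P)"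
      by measurable
    from measurable_compose[OF this f_meas] show ?thesis by (simp add: F_def split_beta)
  qed
  have F0: "integrable P (\<lambda>z. norm (F 0 z))"
  proof -
    have meas: "(\<lambda>z. norm (F 0 z)) \<in> borel_measurable P"
      using measurable_compose[OF measurable_Pair1' F_meas, of 0] by simp
    \<comment> \<open>The moment assumption concerns \<open>Y 1\<close> and \<open>N 2\<close>, that
      is coordinate 1 of the path, while \<open>F\<close> reads coordinate 0; hence one shift,
      removed below by stationarity.\<close>
    have "integrable M (\<lambda>w. norm (F 0 (shift (path w))))"
      using assms(8)[of lam] lam by (simp add: F_def f_def shift_def path_def Z_def)
    then have "integrable (distr M P path) (\<lambda>z. norm (F 0 (shift z)))"
      using path(1) meas by (subst integrable_distr_eq) auto
    then have "integrable (distr P P shift) (\<lambda>z. norm (F 0 z))"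
      unfolding path(2) using meas by (subst integrable_distr_eq) auto
    then show ?thesis by (simp add: fwd.T_preserves)
  qed
  have neg: "ext_expectation P (\<lambda>z. ext_ln (k z)) < 0"
  proof -
    have "(\<lambda>z. ext_ln (k z)) \<in> borel_measurable P"
      using k(1) unfolding ext_ln_def by measurable
    then have "ext_expectation P (\<lambda>z. ext_ln (k z))
        = ext_expectation M (\<lambda>w. ext_ln (k (path w)))"
      using ext_expectation_distr[OF path(1)] unfolding path(2) by blast
    also have "\<dots> < 0" using assms(12)[of lam] lam by (simp add: k_def path_def Z_def)
    finally show ?thesis .
  qed
  \<comment> \<open>For the backward shift the equation says that the step driven by
    \<open>z 0\<close> leads from the state \<open>\<Psi> (\<sigma> z)\<close> to the state
    \<open>\<Psi> z\<close>.\<close>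
  obtain \<Psi> where \<Psi>: "\<Psi> \<in> borel_measurable P" "AE z in P. \<Psi> z = F (\<Psi> (\<sigma> z)) z"
    using bwd.random_fixed_point[OF F_meas F_lip F0 k neg] by blast
  let ?X = "langevin H lam Y N"
  have X_Suc: "?X V (Suc n) w = F (?X V n w) ((shift ^^ n) (path w))" for V n w
    by (simp add: F_def f_def funpow_shift path_def Z_def)
  have X_meas: "?X V n \<in> borel_measurable M" if "V \<in> borel_measurable M" for V n
  proof (induction n)
    case (Suc n)
    then have "(\<lambda>w. (?X V n w, (shift ^^ n) (path w))) \<in> measurable M (borel \<Otimes>\<^sub>M P)"
      using path(1) by measurable
    from measurable_compose[OF this F_meas] show ?case by (simp only: X_Suc[abs_def] case_prod_conv)
  qed (simp add: that)
  \<comment> \<open>The state at time 0 precedes the step driven by coordinate 0, hence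
    \<open>\<sigma>\<close> inside \<open>\<Psi>\<close>.\<close>
  define Vs where "Vs w = \<Psi> (\<sigma> (path w))" for w
  have Vs: "Vs \<in> borel_measurable M"
    unfolding Vs_def by (intro measurable_compose[OF path(1)] measurable_compose[OF _ \<Psi>(1)]) simp
  have \<sigma>_shift: "\<sigma> (shift z) = z" for z by (simp add: \<sigma>_def[abs_def] shift_def)
  have "AE z in distr M P path.
      \<forall>n. \<Psi> ((shift ^^ n) z) = F (\<Psi> (\<sigma> ((shift ^^ n) z))) ((shift ^^ n) z)"
    unfolding path(2) by (rule fwd.AE_iterates[OF \<Psi>(2)])
  from AE_distrD[OF path(1) this]
  have orbit: "AE w in M. \<forall>n. ?X Vs n w = \<Psi> (\<sigma> ((shift ^^ n) (path w)))"
  proof eventually_elim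
    case (elim w)
    have "?X Vs n w = \<Psi> (\<sigma> ((shift ^^ n) (path w)))" for n
    proof (induction n)
      case (Suc n)
      \<comment> \<open>The step at time \<open>n\<close> yields \<open>\<Psi>\<close> at the
        \<open>n\<close>-th shifted path, which is \<open>\<Psi> \<circ> \<sigma>\<close> at the
        next one because \<open>\<sigma>\<close> undoes \<open>shift\<close>.\<close>
      then show ?case using elim by (simp add: X_Suc \<sigma>_shift del: langevin.simps)
    qed (simp add: Vs_def)
    then show ?case by blast
  qed
  have "(\<lambda>z. \<Psi> (\<sigma> z)) \<in> borel_measurable P"
    by (rule measurable_compose[OF bwd.T_measurable \<Psi>(1)])
  note fwd.orbit_observable_stationary_ergodic[OF this path X_meas[OF Vs] orbit]
  moreover have "AE w in M. (\<lambda>n. ?X V n w - ?X Vs n w) \<longlonglongrightarrow> 0" for V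
  proof -
    \<comment> \<open>The estimate is pathwise: both solutions pass through the same maps, so
      \<open>V\<close> may depend on the entire driving trajectories.\<close>
    have bound: "norm (?X V n w - ?X Vs n w)
        \<le> (\<Prod>j<n. k ((shift ^^ j) (path w))) * norm (V w - Vs w)" for n w
    proof (induction n)
      case (Suc n)
      have "norm (?X V (Suc n) w - ?X Vs (Suc n) w)
          \<le> k ((shift ^^ n) (path w)) * norm (?X V n w - ?X Vs n w)"
        unfolding X_Suc by (rule F_lip)
      also have "\<dots> \<le> k ((shift ^^ n) (path w)) *
          ((\<Prod>j<n. k ((shift ^^ j) (path w))) * norm (V w - Vs w))"
        by (intro mult_left_mono Suc k)
      finally show ?case by (simp add: ac_simps)
    qed simp
    obtain d where d: "0 < d"
      "AE z in P. \<exists>C. \<forall>n. (\<Prod>j<n. k ((shift ^^ j) z)) \<le> C * exp (- d * real n)"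
      using fwd.exponential_contraction[OF k neg] by blast
    then have "AE z in distr M P path.
        \<exists>C. \<forall>n. (\<Prod>j<n. k ((shift ^^ j) z)) \<le> C * exp (- d * real n)"
      unfolding path(2) by blast
    from AE_distrD[OF path(1) this] show ?thesis
    proof eventually_elim
      case (elim w)
      then obtain C where C: "\<And>n. (\<Prod>j<n. k ((shift ^^ j) (path w))) \<le> C * exp (- d * real n)"
        by blast
      have "(\<lambda>n. C * exp (- d) ^ n * norm (V w - Vs w)) \<longlonglongrightarrow> C * 0 * norm (V w - Vs w)"
        using d(1) by (intro tendsto_intros LIMSEQ_power_zero) simp
      then have "(\<lambda>n. C * exp (- d * real n) * norm (V w - Vs w)) \<longlonglongrightarrow> 0"
        by (simp add: exp_of_nat_mult[symmetric] mult.commute)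
      then show ?case
      proof (rule Lim_null_comparison[rotated])
        show "\<forall>\<^sub>F n in sequentially. norm (?X V n w - ?X Vs n w)
            \<le> C * exp (- d * real n) * norm (V w - Vs w)"
          by (intro always_eventually allI order_trans[OF bound] mult_right_mono C) simp
      qed
    qed
  qed
  ultimately show "strongly_stable M ?X" unfolding strongly_stable_def using Vs by blast
qed

end
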